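(* Let $a\ge -1$ be an integer and let $K=\mathbb Q(\rho)$, where $\rho$ is a root of the polynomial $x^3-ax^2-(a+3)x-1$. Assume that $\mathcal O_K=\mathbb Z[\rho]$. For $a\ge 4$ write $a=3A+a_0$ with $A\in\mathbb N_0$ and $a_0\in\{0,1,2\}$. If $\alpha$ is indecomposable in $\mathcal O_K$, then \[ N(\alpha)\le \begin{cases} a^2+3a+9 & \text{if } a\le 3,\\ 3A^4+14A^3+28A^2+27A+11 & \text{if } a\ge 4 \text{ and } a_0=2,\\ 3A^4+10A^3+16A^2+13A+5 & \text{if } a\ge 4 \text{ and } a_0=1,\\ 3A^4+6A^3+9A^2+6A+3 & \text{if } a\ge 4 \text{ and } a_0=0. \end{cases} \]
   Context: The field $K$ is a totally real cubic field with ring of integers $\mathcal O_K$. An element of $K$ is totally positive if all its images under the embeddings $K\to\mathbb R$ are positive. A totally positive $\alpha\in\mathcal O_K$ is indecomposable in $\mathcal O_K$ if it cannot be written as $\alpha=\beta+\gamma$ with $\beta,\gamma\in\mathcal O_K$ totally positive. $N$ denotes the norm from $K$ to $\mathbb Q$. *)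

theory Defs
  imports
    Complex_Main
    "HOL-Library.FuncSet"
    "HOL-Computational_Algebra.Polynomial"
begin

text \<open>
  Number fields are represented as subfields of an arbitrary ambient field of characteristic 0,
  given by a type of class \<^class>\<open>field_char_0\<close>. This covers both abstract number fields
  (the subfield may be the whole type) and fields of real or complex numbers.
\<close>

definition is_subfield :: "'k::field set \<Rightarrow> bool" where
  "is_subfield F \<longleftrightarrow>
     1 \<in> F \<and> (\<forall>x\<in>F. \<forall>y\<in>F. x - y \<in> F \<and> x * y \<in> F) \<and> (\<forall>x\<in>F. inverse x \<in> F)"

text \<open>In characteristic 0 every subfield contains \<open>\<rat>\<close>, so this is \<open>\<rat>(r)\<close>.\<close>

definition rat_adjoin :: "'k::field_char_0 \<Rightarrow> 'k set" where
  "rat_adjoin r = \<Inter>{F. is_subfield F \<and> r \<in> F}"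

definition int_adjoin :: "'k::field_char_0 \<Rightarrow> 'k set" where
  "int_adjoin r = range (\<lambda>p :: int poly. poly (map_poly of_int p) r)"

definition ring_of_integers :: "'k::field_char_0 set \<Rightarrow> 'k set" where
  "ring_of_integers K = {x \<in> K. algebraic_int x}"

text \<open>
  Embeddings are only relevant on \<open>K\<close>; they are made \<^const>\<open>extensional\<close> so that distinct
  elements of this set are distinct as maps on \<open>K\<close>, and products over it count each embedding
  once.
\<close>

definition embeddings :: "'k::field_char_0 set \<Rightarrow> ('k \<Rightarrow> 'l::field_char_0) set" where
  "embeddings K = {\<sigma> \<in> extensional K.
     \<sigma> 1 = 1 \<and> (\<forall>x\<in>K. \<forall>y\<in>K. \<sigma> (x + y) = \<sigma> x + \<sigma> y \<and> \<sigma> (x * y) = \<sigma> x * \<sigma> y)}"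

definition totally_positive :: "'k::field_char_0 set \<Rightarrow> 'k \<Rightarrow> bool" where
  "totally_positive K x \<longleftrightarrow> x \<in> K \<and> (\<forall>\<sigma> \<in> (embeddings K :: ('k \<Rightarrow> real) set). \<sigma> x > 0)"

definition indecomposable :: "'k::field_char_0 set \<Rightarrow> 'k \<Rightarrow> bool" where
  "indecomposable K \<alpha> \<longleftrightarrow>
     \<alpha> \<in> ring_of_integers K \<and> totally_positive K \<alpha> \<and>
     \<not> (\<exists>\<beta> \<in> ring_of_integers K. \<exists>\<gamma> \<in> ring_of_integers K.
          totally_positive K \<beta> \<and> totally_positive K \<gamma> \<and> \<alpha> = \<beta> + \<gamma>)"

text \<open>
  The norm of a number field \<open>K\<close> over \<open>\<rat>\<close>: the product of the images under all embeddings
  into \<open>\<complex>\<close>. This product is a rational number, and the norm is that number.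
\<close>

definition field_norm :: "'k::field_char_0 set \<Rightarrow> 'k \<Rightarrow> rat" where
  "field_norm K x =
     (THE q. of_rat q = (\<Prod>\<sigma> \<in> (embeddings K :: ('k \<Rightarrow> complex) set). \<sigma> x))"

end

theory Submission
  imports Defs "HOL-Library.Product_Plus"
begin

text \<open>
  Let \<open>\<rho>, \<rho>', \<rho>''\<close> be the conjugates, cyclically permuted by \<open>t \<mapsto> - 1 - 1 / t\<close>. Norm and
  indecomposability of \<open>x + y \<rho> + z \<rho>\<^sup>2\<close> are preserved by conjugation and by multiplication with
  squares of units, so one may descend on the positive integer \<open>x + z\<close>. If \<open>y > 0\<close>, then either
  multiplication by \<open>\<rho>''\<^sup>2\<close> or division by \<open>\<rho>'\<^sup>2\<close> lowers \<open>x + z\<close>, or \<open>x, z \<ge> y\<close>, and then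
  subtracting \<open>1 + \<rho> + \<rho>\<^sup>2\<close> shows that the element is \<open>1 + \<rho> + \<rho>\<^sup>2\<close>, of norm \<open>a\<^sup>2 + 3 a + 9\<close>.
  The symmetry \<open>x \<mapsto> \<rho>\<^sup>2 x''\<close>, which preserves \<open>x + z\<close>, gives two more such reductions; when none
  of the three applies, the element lies in the cone spanned by \<open>1\<close>, \<open>\<rho>\<^sup>2\<close>, \<open>(\<rho> \<rho>'')\<^sup>2\<close>. There
  every lattice point is a sum of lattice points with \<open>x + z = 1\<close>, which form a triangle: its three
  vertices are units, and its inner points have barycentric coordinates \<open>b1, b2, b3 \<ge> 0\<close> with sum
  \<open>a\<close>. The norm is an explicit cyclic polynomial in these, largest when they are as equal as
  possible.
\<close>

section \<open>Maximal norm on the triangle\<close>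

text \<open>Norm of the level \<open>1\<close> point with barycentric coordinates \<open>b1\<close>,
  \<open>b2\<close>, \<open>b3\<close>, where \<open>a\<close> has been eliminated as their
  sum.\<close>

definition tri_norm :: "int \<Rightarrow> int \<Rightarrow> int \<Rightarrow> int" where
  "tri_norm b1 b2 b3 = (b1 + b2 + b3 + 3) * (b1 * b2 * b3) + (b1\<^sup>2 * b2 + b2\<^sup>2 * b3 + b3\<^sup>2 * b1)
     + 3 * (b1 * b2 + b2 * b3 + b3 * b1) + 2 * (b1 + b2 + b3) + 3"

definition tri_bound :: "int \<Rightarrow> int \<Rightarrow> int" where
  "tri_bound A a0 = (if a0 = 2 then 3*A^4 + 14*A^3 + 28*A^2 + 27*A + 11
     else if a0 = 1 then 3*A^4 + 10*A^3 + 16*A^2 + 13*A + 5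
     else 3*A^4 + 6*A^3 + 9*A^2 + 6*A + 3)"

lemma tri_norm_rotate: "tri_norm b1 b2 b3 = tri_norm b2 b3 b1"
  unfolding tri_norm_def by algebra

text \<open>For fixed minimum \<open>m\<close> and total excess \<open>S\<close>, only terms in
  \<open>p * q\<close> and \<open>p^2 * q\<close> depend on the split. These obey
  \<open>4 * (p * q) \<le> S^2\<close> and \<open>4 * (p^2 * q) \<le> S^3\<close>; the factor
  \<open>4\<close> avoids fractions.\<close>

lemma tri_norm_shift_le:
  assumes "p \<ge> 0" "q \<ge> 0" "m \<ge> 0"
  defines "S \<equiv> p + q"
  shows "4 * tri_norm m (m + p) (m + q) \<le> (3*m + S + 3) * (4*m^3 + 4*m^2*S + m*S^2)
     + 12*m^3 + 12*m^2*S + 4*m*S^2 + S^3 + 36*m^2 + 24*m*S + 3*S^2 + 8*(3*m + S) + 12"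
proof -
  have pq: "4 * (p * q) \<le> S^2"
    using zero_le_power2[of "p - q"] unfolding S_def by (simp add: power2_eq_square algebra_simps)
  have "p * (p * q) \<le> S * (p * q)"
    using assms by (intro mult_right_mono) auto
  moreover have "S * (4 * (p * q)) \<le> S * S^2"
    using assms pq by (intro mult_left_mono) auto
  ultimately have ppq: "4 * (p^2 * q) \<le> S^3"
    by (simp add: power2_eq_square power3_eq_cube algebra_simps)
  have "((3*m + S + 3) * m + 3) * (4 * (p * q)) \<le> ((3*m + S + 3) * m + 3) * S^2"
    using assms pq by (intro mult_left_mono) auto
  moreover have "4 * tri_norm m (m + p) (m + q) = ((3*m + S + 3) * m + 3) * (4 * (p * q)) + 4 * (p^2 * q)
     + (3*m + S + 3) * (4*m^3 + 4*m^2*S)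
     + 12*m^3 + 12*m^2*S + 4*m*S^2 + 36*m^2 + 24*m*S + 8*(3*m + S) + 12"
    unfolding tri_norm_def S_def by algebra
  moreover have "((3*m + S + 3) * m + 3) * S^2 = (3*m + S + 3) * (m * S^2) + 3 * S^2"
    by algebra
  moreover have "(3*m + S + 3) * (4*m^3 + 4*m^2*S + m*S^2)
      = (3*m + S + 3) * (m * S^2) + (3*m + S + 3) * (4*m^3 + 4*m^2*S)"
    by algebra
  ultimately show ?thesis using ppq by linarith
qed

text \<open>If \<open>b1 = A\<close>, few excesses \<open>p\<close>, \<open>q\<close> remain.
  Otherwise \<open>j = A - b1 - 1\<close> is nonnegative, and \<open>4 * tri_bound A a0\<close>
  exceeds the estimate of \<open>tri_norm_shift_le\<close> by a polynomial in \<open>b1\<close> and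
  \<open>j\<close> with positive coefficients.\<close>

lemma tri_norm_min_first_le:
  fixes A a0 b1 b2 b3 :: int
  assumes "0 \<le> b1" "b1 \<le> b2" "b1 \<le> b3" "b1 + b2 + b3 = 3 * A + a0" "a0 \<in> {0, 1, 2}"
  shows "tri_norm b1 b2 b3 \<le> tri_bound A a0"
proof -
  define p q where "p = b2 - b1" and "q = b3 - b1"
  have pq: "p \<ge> 0" "q \<ge> 0" and b: "b2 = b1 + p" "b3 = b1 + q"
    using assms by (auto simp: p_def q_def)
  have S: "p + q = a0 + 3 * (A - b1)" using assms(4) b by simp
  have "b1 \<le> A" using assms by auto
  show ?thesis
  proof (cases "b1 = A")
    case True
    then have "p + q = a0" using S by simp
    then consider "p = 0" "q = 0" "a0 = 0" | "p = 1" "q = 0" "a0 = 1" | "p = 0" "q = 1" "a0 = 1"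
      | "p = 2" "q = 0" "a0 = 2" | "p = 1" "q = 1" "a0 = 2" | "p = 0" "q = 2" "a0 = 2"
    proof -
      have "p = 0 \<or> p = 1 \<or> p = 2" using \<open>p + q = a0\<close> assms(5) pq by auto
      then show ?thesis using \<open>p + q = a0\<close> assms(5) pq that by auto
    qed
    then show ?thesis
      using assms(1) True
      by cases (auto simp: b tri_norm_def tri_bound_def algebra_simps power2_eq_square power3_eq_cube power4_eq_xxxx)
  next
    case False
    define j where "j = A - b1 - 1"
    have j: "j \<ge> 0" "A = b1 + j + 1" using False \<open>b1 \<le> A\<close> by (auto simp: j_def)
    have S': "p + q = a0 + 3 * (j + 1)" using S j by simp
    have m0: "0 \<le> b1" by fact
    let ?m = b1
    \<comment> \<open>Exponents \<open>0\<close> and \<open>1\<close> are kept in the identities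
      below, so that the subtracted monomials are literal instances of this fact.\<close>
    have nn: "0 \<le> ?m^i * j^k" for i k using j(1) m0 by simp
    note bd = tri_norm_shift_le[OF pq m0, unfolded S', folded b]
    from assms(5) consider "a0 = 0" | "a0 = 1" | "a0 = 2" by auto
    then show ?thesis
    proof cases
      case 1
      have "4 * tri_bound A a0 - (9*(?m^2*j^2) + 18*(?m^2*j^1) + 9*(?m^2*j^0) + 21*(?m^1*j^3) + 72*(?m^1*j^2)
        + 81*(?m^1*j^1) + 30*(?m^1*j^0) + 12*(?m^0*j^4) + 45*(?m^0*j^3) + 72*(?m^0*j^2) + 57*(?m^0*j^1) + 18)
        = (3*?m + (a0 + 3*(j+1)) + 3) * (4*?m^3 + 4*?m^2*(a0 + 3*(j+1)) + ?m*(a0 + 3*(j+1))^2)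
     + 12*?m^3 + 12*?m^2*(a0 + 3*(j+1)) + 4*?m*(a0 + 3*(j+1))^2 + (a0 + 3*(j+1))^3 + 36*?m^2 + 24*?m*(a0 + 3*(j+1)) + 3*(a0 + 3*(j+1))^2 + 8*(3*?m + (a0 + 3*(j+1))) + 12"
        unfolding tri_bound_def 1 j(2) by (simp add: algebra_simps power2_eq_square power3_eq_cube power4_eq_xxxx)
      then show ?thesis
        using bd nn[of 2 2] nn[of 2 1] nn[of 2 0] nn[of 1 3] nn[of 1 2] nn[of 1 1] nn[of 1 0]
          nn[of 0 4] nn[of 0 3] nn[of 0 2] nn[of 0 1] by linarith
    next
      case 2
      have "4 * tri_bound A a0 - (9*(?m^2*j^2) + 24*(?m^2*j^1) + 12*(?m^2*j^0) + 21*(?m^1*j^3) + 93*(?m^1*j^2)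
        + 128*(?m^1*j^1) + 52*(?m^1*j^0) + 12*(?m^0*j^4) + 61*(?m^0*j^3) + 121*(?m^0*j^2) + 108*(?m^0*j^1) + 32)
        = (3*?m + (a0 + 3*(j+1)) + 3) * (4*?m^3 + 4*?m^2*(a0 + 3*(j+1)) + ?m*(a0 + 3*(j+1))^2)
     + 12*?m^3 + 12*?m^2*(a0 + 3*(j+1)) + 4*?m*(a0 + 3*(j+1))^2 + (a0 + 3*(j+1))^3 + 36*?m^2 + 24*?m*(a0 + 3*(j+1)) + 3*(a0 + 3*(j+1))^2 + 8*(3*?m + (a0 + 3*(j+1))) + 12"
        unfolding tri_bound_def 2 j(2) by (simp add: algebra_simps power2_eq_square power3_eq_cube power4_eq_xxxx)
      then show ?thesis
        using bd nn[of 2 2] nn[of 2 1] nn[of 2 0] nn[of 1 3] nn[of 1 2] nn[of 1 1] nn[of 1 0]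
          nn[of 0 4] nn[of 0 3] nn[of 0 2] nn[of 0 1] by linarith
    next
      case 3
      have "4 * tri_bound A a0 - (9*(?m^2*j^2) + 30*(?m^2*j^1) + 21*(?m^2*j^0) + 21*(?m^1*j^3) + 114*(?m^1*j^2)
        + 197*(?m^1*j^1) + 104*(?m^1*j^0) + 12*(?m^0*j^4) + 77*(?m^0*j^3) + 190*(?m^0*j^2) + 209*(?m^0*j^1) + 80)
        = (3*?m + (a0 + 3*(j+1)) + 3) * (4*?m^3 + 4*?m^2*(a0 + 3*(j+1)) + ?m*(a0 + 3*(j+1))^2)
     + 12*?m^3 + 12*?m^2*(a0 + 3*(j+1)) + 4*?m*(a0 + 3*(j+1))^2 + (a0 + 3*(j+1))^3 + 36*?m^2 + 24*?m*(a0 + 3*(j+1)) + 3*(a0 + 3*(j+1))^2 + 8*(3*?m + (a0 + 3*(j+1))) + 12"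
        unfolding tri_bound_def 3 j(2) by (simp add: algebra_simps power2_eq_square power3_eq_cube power4_eq_xxxx)
      then show ?thesis
        using bd nn[of 2 2] nn[of 2 1] nn[of 2 0] nn[of 1 3] nn[of 1 2] nn[of 1 1] nn[of 1 0]
          nn[of 0 4] nn[of 0 3] nn[of 0 2] nn[of 0 1] by linarith
    qed
  qed
qed

lemma tri_norm_le:
  fixes A a0 b1 b2 b3 :: int
  assumes "0 \<le> b1" "0 \<le> b2" "0 \<le> b3" "b1 + b2 + b3 = 3 * A + a0" "a0 \<in> {0, 1, 2}"
  shows "tri_norm b1 b2 b3 \<le> tri_bound A a0"
proof -
  consider "b1 \<le> b2" "b1 \<le> b3" | "b2 \<le> b3" "b2 \<le> b1" | "b3 \<le> b1" "b3 \<le> b2" by linarith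
  then show ?thesis
  proof cases
    case 1 with assms show ?thesis by (intro tri_norm_min_first_le)
  next
    case 2
    have "tri_norm b2 b3 b1 \<le> tri_bound A a0" by (rule tri_norm_min_first_le) (use 2 assms in auto)
    then show ?thesis by (simp only: tri_norm_rotate[of b1])
  next
    case 3
    have "tri_norm b3 b1 b2 \<le> tri_bound A a0" by (rule tri_norm_min_first_le) (use 3 assms in auto)
    then show ?thesis by (simp only: tri_norm_rotate[of b3])
  qed
qed

section \<open>Coordinates and conjugation\<close>

definition ev :: "'a::comm_ring_1 \<Rightarrow> 'a \<times> 'a \<times> 'a \<Rightarrow> 'a" where
  "ev t = (\<lambda>(x, y, z). x + y * t + z * t\<^sup>2)"

definition root_of :: "int \<Rightarrow> 'a::comm_ring_1 \<Rightarrow> bool" where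
  "root_of a t \<longleftrightarrow> t ^ 3 = of_int a * t\<^sup>2 + (of_int a + 3) * t + 1"

text \<open>The triple \<open>(x, y, z)\<close> stands for \<open>x + y \<rho> + z \<rho>\<^sup>2\<close>, and \<open>conj3\<close> for the automorphism
  \<open>\<rho> \<mapsto> \<rho>'' = - 1 / (1 + \<rho>) = - 2 - (a + 1) \<rho> + \<rho>\<^sup>2\<close>.\<close>

definition conj3 :: "'a::comm_ring_1 \<Rightarrow> 'a \<times> 'a \<times> 'a \<Rightarrow> 'a \<times> 'a \<times> 'a" where
  "conj3 a = (\<lambda>(x, y, z). (x - 2 * y + (2 - a) * z, - (a + 1) * y - (a\<^sup>2 + a + 1) * z, y + a * z))"

definition mul_root :: "'a::comm_ring_1 \<Rightarrow> 'a \<times> 'a \<times> 'a \<Rightarrow> 'a \<times> 'a \<times> 'a" where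
  "mul_root a = (\<lambda>(x, y, z). (z, x + (a + 3) * z, y + a * z))"

text \<open>No denominators occur since \<rho> is a unit:
  \<open>1 / \<rho> = \<rho>^2 - a * \<rho> - (a + 3)\<close>.\<close>

definition div_root :: "'a::comm_ring_1 \<Rightarrow> 'a \<times> 'a \<times> 'a \<Rightarrow> 'a \<times> 'a \<times> 'a" where
  "div_root a = (\<lambda>(x, y, z). (y - (a + 3) * x, z - a * x, x))"

text \<open>The norm form: the product of the three conjugates, expanded in elementary symmetric
  functions of the roots (\<open>norm3_eq\<close>).\<close>

definition norm3 :: "'a::comm_ring_1 \<Rightarrow> 'a \<times> 'a \<times> 'a \<Rightarrow> 'a" where
  "norm3 a = (\<lambda>(x, y, z). x^3 + y^3 + z^3 + a * x\<^sup>2 * y + (a\<^sup>2 + 2 * a + 6) * x\<^sup>2 * z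
     - (a + 3) * x * y\<^sup>2 - (a\<^sup>2 + 3 * a + 3) * x * y * z + (a\<^sup>2 + 4 * a + 9) * x * z\<^sup>2
     + a * y\<^sup>2 * z - (a + 3) * y * z\<^sup>2)"

lemma mul_root_div_root: "mul_root a (div_root a s) = s" "div_root a (mul_root a s) = s"
  by (cases s; simp add: mul_root_def div_root_def algebra_simps)+

lemma conj3_conj3_conj3: "conj3 a (conj3 a (conj3 a s)) = s"
  by (cases s) (simp add: conj3_def algebra_simps power2_eq_square)

lemma conj3_add: "conj3 a (s + u) = conj3 a s + conj3 a u"
  and mul_root_add: "mul_root a (s + u) = mul_root a s + mul_root a u"
  and div_root_add: "div_root a (s + u) = div_root a s + div_root a u"
  by (cases s; cases u; simp add: conj3_def mul_root_def div_root_def algebra_simps)+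

lemma ev_add: "ev t (s + u) = ev t s + ev t u"
  by (cases s; cases u) (simp add: ev_def algebra_simps)

lemma ev_mul_root:
  assumes "root_of a t"
  shows "ev t (mul_root (of_int a) s) = t * ev t s"
proof (cases s)
  case (fields x y z)
  from assms have "z * t ^ 3 = z * (of_int a * t\<^sup>2 + (of_int a + 3) * t + 1)" by (simp add: root_of_def)
  then show ?thesis
    by (simp add: fields ev_def mul_root_def power2_eq_square power3_eq_cube algebra_simps)
qed

lemma norm3_conj3: "norm3 a (conj3 a s) = norm3 a s"
  by (cases s) (simp add: norm3_def conj3_def algebra_simps power2_eq_square power3_eq_cube)

lemma norm3_mul_root: "norm3 a (mul_root a s) = norm3 a s"
  by (cases s) (simp add: norm3_def mul_root_def algebra_simps power2_eq_square power3_eq_cube)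

lemma norm3_div_root: "norm3 a (div_root a s) = norm3 a s"
  by (metis norm3_mul_root mul_root_div_root(1))

definition of_int3 :: "int \<times> int \<times> int \<Rightarrow> 'a::ring_1 \<times> 'a \<times> 'a" where
  "of_int3 = (\<lambda>(x, y, z). (of_int x, of_int y, of_int z))"

lemma of_int3_add: "of_int3 (s + u) = of_int3 s + of_int3 u"
  by (cases s; cases u) (simp add: of_int3_def)

lemma of_int3_conj3: "of_int3 (conj3 a s) = conj3 (of_int a) (of_int3 s)"
  and of_int3_mul_root: "of_int3 (mul_root a s) = mul_root (of_int a) (of_int3 s)"
  and of_int_norm3: "of_int (norm3 a s) = norm3 (of_int a) (of_int3 s)"
  by (cases s; simp add: of_int3_def conj3_def mul_root_def norm3_def)+

text \<open>The first three equations are \<open>t \<mapsto> - 1 - 1 / t\<close> without division,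
  the last two are Vieta relations. The set is cyclically symmetric, so facts about \<open>p\<close>
  transfer to \<open>q\<close> and \<open>r\<close>.\<close>

locale root_cycle =
  fixes a :: int and p q r :: "'a::field_char_0"
  assumes pq: "p * q = - 1 - p" and qr: "q * r = - 1 - q" and rp: "r * p = - 1 - r"
    and sum: "p + q + r = of_int a" and pqr: "p * q * r = 1"
begin

lemma cycle: "root_cycle a q r p"
  using pq qr rp sum pqr by unfold_locales (simp_all add: algebra_simps)

lemma r_eq: "r = - 2 - (of_int a + 1) * p + p\<^sup>2"
  using pq rp sum by algebra

lemma root: "root_of a p"
  unfolding root_of_def using pq rp sum pqr by algebra

lemma ev_conj3: "ev p (conj3 (of_int a) s) = ev r s"
proof -
  have r2: "r\<^sup>2 = (2 - of_int a) - ((of_int a)\<^sup>2 + of_int a + 1) * p + of_int a * p\<^sup>2"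
    using r_eq root unfolding root_of_def by algebra
  show ?thesis
  proof (cases s)
    case (fields x y z)
    show ?thesis
      unfolding fields ev_def prod.case r2 by (subst r_eq) (simp add: conj3_def algebra_simps)
  qed
qed

lemma norm3_eq: "norm3 (of_int a) s = ev p s * ev q s * ev r s"
proof (cases s)
  case (fields x y z)
  have 1: "p * q + q * r + r * p = - (of_int a + 3)" using pq qr rp sum by algebra
  show ?thesis unfolding fields ev_def norm3_def using 1 sum pqr
    by (simp, algebra)
qed

end

text \<open>One root generates all three, in the abstract field as well as in the reals.\<close>

lemma root_cycleI:
  fixes t :: "'a::field_char_0"
  assumes "root_of a t"
  shows "root_cycle a t (- 1 - 1 / t) (- 1 / (1 + t))"
proof -
  have t0: "t \<noteq> 0" using assms by (auto simp: root_of_def)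
  have t1: "1 + t \<noteq> 0"
  proof
    assume "1 + t = 0"
    then have "t = - 1" by (simp add: eq_neg_iff_add_eq_0 add.commute)
    with assms show False by (simp add: root_of_def)
  qed
  show ?thesis
  proof
    show "t + (- 1 - 1 / t) + - 1 / (1 + t) = of_int a"
      using t0 t1 assms unfolding root_of_def by (simp add: divide_simps; algebra)
  qed (use t0 t1 in \<open>simp_all add: divide_simps\<close>, (simp_all add: algebra_simps)?)
qed

section \<open>Descent on indecomposable elements\<close>

text \<open>\<open>level\<close> is \<open>x \<mapsto> Tr (\<delta> x)\<close> for a totally positive \<open>\<delta>\<close> of the codifferent; hence it is
  positive on totally positive elements.\<close>

definition level :: "int \<times> int \<times> int \<Rightarrow> int" where
  "level = (\<lambda>(x, y, z). x + z)"

text \<open>\<open>cone_rot\<close> is \<open>x \<mapsto> \<rho>\<^sup>2 x''\<close>. It permutes the generators \<open>1\<close>, \<open>\<rho>\<^sup>2\<close>, \<open>(\<rho> \<rho>'')\<^sup>2\<close> of the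
  cone \<open>in_cone\<close> below cyclically, all of which have level \<open>1\<close>.\<close>

definition cone_rot :: "int \<Rightarrow> int \<times> int \<times> int \<Rightarrow> int \<times> int \<times> int" where
  "cone_rot a s = mul_root a (mul_root a (conj3 a s))"

lemma cone_rot_eq:
  "cone_rot a (x, y, z) = (- y - (1 + a) * z, - (a + 2) * y - (a^2 + 3 * a + 3) * z, x + y + (a + 2) * z)"
  by (simp add: cone_rot_def mul_root_def conj3_def algebra_simps power2_eq_square)

lemma norm3_cone_rot: "norm3 a (cone_rot a s) = norm3 a s"
  by (simp add: cone_rot_def norm3_mul_root norm3_conj3)

lemma level_cone_rot: "level (cone_rot a s) = level s"
  by (cases s) (simp add: level_def cone_rot_eq algebra_simps)

text \<open>The two maps are multiplication by \<open>\<rho>''\<^sup>2\<close> and by \<open>\<rho>'\<close> to the power \<open>- 2\<close>.\<close>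

lemma level_mul_root_conj3:
  "level (conj3 a (mul_root a (mul_root a (conj3 a (conj3 a (x, y, z)))))) = 2 * x - y + z"
  "level (conj3 a (conj3 a (div_root a (div_root a (conj3 a (x, y, z)))))) = x - y + 2 * z"
  by (simp_all add: conj3_def mul_root_def div_root_def level_def algebra_simps power2_eq_square)

text \<open>With \<open>D = a^2 + 3 * a + 3\<close>, the coordinates in the basis \<open>1\<close>,
  \<open>\<rho>^2\<close>, \<open>(\<rho> \<rho>'')^2\<close>, scaled by \<open>D\<close>, are
  \<open>D * x - (a + 1) * y\<close>, \<open>(a + 2) * y + D * z\<close> and
  \<open>- y\<close>.\<close>

definition in_cone :: "int \<Rightarrow> int \<times> int \<times> int \<Rightarrow> bool" where
  "in_cone a = (\<lambda>(x, y, z). y \<le> 0 \<and> 0 \<le> (a + 2) * y + (a^2 + 3 * a + 3) * z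
     \<and> (a + 1) * y \<le> (a^2 + 3 * a + 3) * x)"

text \<open>The faces are permuted by \<open>cone_rot\<close>, so an element outside the cone has a
  rotation with positive middle coordinate.\<close>

lemma in_cone_iff:
  "in_cone a s \<longleftrightarrow> fst (snd s) \<le> 0 \<and> fst (snd (cone_rot a s)) \<le> 0
     \<and> fst (snd (cone_rot a (cone_rot a s))) \<le> 0"
  by (cases s) (simp add: in_cone_def cone_rot_eq algebra_simps power2_eq_square; linarith)

lemma in_cone_cone_rot: "in_cone a (cone_rot a s) \<longleftrightarrow> in_cone a s"
  by (cases s) (simp add: in_cone_def cone_rot_eq algebra_simps power2_eq_square; linarith)

lemma (in root_cycle) rp_square:
  "(r * p)\<^sup>2 = - 1 - of_int a - ((of_int a)\<^sup>2 + 3 * of_int a + 3) * p + (of_int a + 2) * p\<^sup>2"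
  using pq rp sum by algebra

locale real_root_cycle = root_cycle a p q r for a and p q r :: real +
  assumes a_ge: "- 1 \<le> a" and p_pos: "0 < p" and q_less: "q < - 1" and r_greater: "- 1 < r" and r_neg: "r < 0"
begin

section \<open>Total positivity and indecomposability of integer triples\<close>

definition tot_pos :: "int \<times> int \<times> int \<Rightarrow> bool" where
  "tot_pos s \<longleftrightarrow> 0 < ev p (of_int3 s) \<and> 0 < ev q (of_int3 s) \<and> 0 < ev r (of_int3 s)"

definition indec :: "int \<times> int \<times> int \<Rightarrow> bool" where
  "indec s \<longleftrightarrow> tot_pos s \<and> \<not> (\<exists>u v. tot_pos u \<and> tot_pos v \<and> s = u + v)"

lemma tot_pos_conj3: "tot_pos (conj3 a s) \<longleftrightarrow> tot_pos s"
  unfolding tot_pos_def of_int3_conj3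
  using ev_conj3 root_cycle.ev_conj3[OF cycle] root_cycle.ev_conj3[OF root_cycle.cycle[OF cycle]]
  by auto

text \<open>The multiplication is applied twice because \<open>q\<close> and \<open>r\<close> are
  negative, while squares are totally positive.\<close>

lemma tot_pos_mul_root_mul_root: "tot_pos (mul_root a (mul_root a s)) \<longleftrightarrow> tot_pos s"
  using p_pos q_less r_neg root root_cycle.root[OF cycle] root_cycle.root[OF root_cycle.cycle[OF cycle]]
  by (simp add: tot_pos_def of_int3_mul_root ev_mul_root zero_less_mult_iff mult_less_0_iff)

lemma tot_pos_div_root_div_root: "tot_pos (div_root a (div_root a s)) \<longleftrightarrow> tot_pos s"
  by (metis mul_root_div_root(1) tot_pos_mul_root_mul_root)

text \<open>A decomposition of \<open>F s\<close> is carried by the additive map \<open>G\<close> to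
  one of \<open>s\<close>.\<close>

lemma indec_image:
  assumes "\<And>u v. G (u + v) = G u + G v" "\<And>s. tot_pos (G s) \<longleftrightarrow> tot_pos s" "G (F s) = s" "indec s"
  shows "indec (F s)"
  using assms unfolding indec_def by metis

lemma indec_conj3: "indec s \<Longrightarrow> indec (conj3 a s)"
  by (rule indec_image[where G = "\<lambda>s. conj3 a (conj3 a s)"])
    (simp_all add: conj3_add tot_pos_conj3 conj3_conj3_conj3)

lemma indec_mul_root_mul_root: "indec s \<Longrightarrow> indec (mul_root a (mul_root a s))"
  by (rule indec_image[where G = "\<lambda>s. div_root a (div_root a s)"])
    (simp_all add: div_root_add tot_pos_div_root_div_root mul_root_div_root)

lemma indec_div_root_div_root: "indec s \<Longrightarrow> indec (div_root a (div_root a s))"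
  by (rule indec_image[where G = "\<lambda>s. mul_root a (mul_root a s)"])
    (simp_all add: mul_root_add tot_pos_mul_root_mul_root mul_root_div_root)

lemma indec_cone_rot: "indec s \<Longrightarrow> indec (cone_rot a s)"
  unfolding cone_rot_def by (intro indec_mul_root_mul_root indec_conj3)

lemma indec_tot_pos_minus: "indec s \<Longrightarrow> tot_pos u \<Longrightarrow> \<not> tot_pos (s - u)"
  unfolding indec_def by (metis add_diff_cancel_left' add.commute diff_add_cancel)

text \<open>Lagrange interpolation at \<open>p\<close>, \<open>q\<close>, \<open>r\<close>: after
  clearing the Vandermonde product, all three conjugates have negative coefficients, and that
  product is negative too.\<close>

lemma level_pos:
  assumes "tot_pos s"
  shows "0 < level s"
proof (cases s)
  case (fields x y z)
  let ?P = "ev p (of_int3 s)" and ?Q = "ev q (of_int3 s)" and ?R = "ev r (of_int3 s)"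
  have "(of_int x + of_int z) * ((p - q) * (p - r) * (q - r))
      = - (q * (q - r)) * ?P + r * (p - r) * ?Q - p * (p - q) * ?R"
    unfolding fields ev_def of_int3_def prod.case using pq qr rp by algebra
  moreover have "- (q * (q - r)) * ?P < 0"
    using assms q_less r_greater by (simp add: tot_pos_def mult_neg_neg)
  moreover have "r * (p - r) * ?Q < 0"
    using assms p_pos r_neg by (simp add: tot_pos_def mult_less_0_iff zero_less_mult_iff)
  moreover have "p * (p - q) * ?R > 0"
    using assms p_pos q_less by (simp add: tot_pos_def)
  ultimately have "(of_int x + of_int z) * ((p - q) * (p - r) * (q - r)) < 0" by linarith
  moreover have "(p - q) * (p - r) * (q - r) < 0"
    using p_pos q_less r_greater r_neg by (simp add: mult_less_0_iff zero_less_mult_iff)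
  ultimately have "0 < real_of_int x + of_int z"
    by (simp add: mult_less_0_iff)
  then show ?thesis unfolding fields level_def by simp
qed

text \<open>The generators are squares of units, so at each root \<open>D\<close> times the value is
  a nonnegative, nontrivial combination of positive numbers.\<close>

lemma tot_pos_in_cone:
  assumes "in_cone a s" "s \<noteq> (0, 0, 0)"
  shows "tot_pos s"
proof (cases s)
  case (fields x y z)
  define D where "D = a^2 + 3 * a + 3"
  have "D = (a + 1)^2 + (a + 1) + 1" unfolding D_def by algebra
  then have D: "D > 0" using a_ge zero_le_power2[of "a + 1"] by linarith
  let ?c0 = "D * x - (a + 1) * y" and ?c1 = "(a + 2) * y + D * z"
  have c: "0 \<le> ?c0" "0 \<le> ?c1" "0 \<le> - y"
    using assms(1) unfolding fields in_cone_def D_def by auto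
  have ne: "0 < ?c0 \<or> 0 < ?c1 \<or> 0 < - y"
  proof (rule ccontr)
    assume "\<not> ?thesis"
    with c have "y = 0" "D * x = 0" "D * z = 0" by auto
    with D assms(2) fields show False by simp
  qed
  have *: "0 < ev t (of_int3 s)" if "root_cycle a t t' t''" "t \<noteq> 0" "t'' \<noteq> 0" for t t' t'' :: real
  proof -
    interpret t: root_cycle a t t' t'' by fact
    have "of_int D * ev t (of_int3 s) = of_int ?c0 + of_int ?c1 * t\<^sup>2 + of_int (- y) * (t'' * t)\<^sup>2"
      unfolding fields ev_def of_int3_def prod.case D_def t.rp_square by (simp add: algebra_simps)
    moreover have "0 < of_int ?c0 + of_int ?c1 * t\<^sup>2 + of_int (- y) * (t'' * t)\<^sup>2"
    proof -
      have "0 \<le> real_of_int ?c0" "0 \<le> of_int ?c1 * t\<^sup>2" "0 \<le> of_int (- y) * (t'' * t)\<^sup>2"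
        using c by (simp_all only: of_int_0_le_iff zero_le_power2 mult_nonneg_nonneg)
      moreover have "0 < real_of_int ?c0 \<or> 0 < of_int ?c1 * t\<^sup>2 \<or> 0 < of_int (- y) * (t'' * t)\<^sup>2"
        using ne
      proof (elim disjE)
        assume "0 < ?c1"
        then have "0 < of_int ?c1 * t\<^sup>2" using that by (intro mult_pos_pos) (simp_all only: of_int_0_less_iff zero_less_power2 not_False_eq_True)
        then show ?thesis by blast
      next
        assume "0 < - y"
        then have "0 < of_int (- y) * (t'' * t)\<^sup>2" using that by (intro mult_pos_pos) (simp_all only: of_int_0_less_iff zero_less_power2 not_False_eq_True mult_eq_0_iff simp_thms)
        then show ?thesis by blast
      qed (simp only: of_int_0_less_iff simp_thms)
      ultimately show ?thesis by linarith
    qed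
    ultimately show ?thesis using D by (metis of_int_0_less_iff zero_less_mult_pos)
  qed
  have "root_cycle a p q r" ..
  then show ?thesis
    using *[of p q r] *[of q r p] *[of r p q] cycle root_cycle.cycle[OF cycle] p_pos q_less r_neg
    unfolding tot_pos_def by auto
qed

lemma indec_y_pos_cases:
  assumes "indec (x, y, z)" "y > 0"
  shows "(x, y, z) = (1, 1, 1) \<or> (\<exists>s. indec s \<and> norm3 a s = norm3 a (x, y, z) \<and> level s < level (x, y, z))"
proof -
  consider "x < y" | "z < y" | "y \<le> x" "y \<le> z" by linarith
  then show ?thesis
  proof cases
    \<comment> \<open>The level changes by \<open>x - y\<close> under this move, and by
      \<open>z - y\<close> under the one of the next case.\<close>
    case 1
    then show ?thesis
      using assms(1)
      by (intro disjI2 exI[of _ "conj3 a (mul_root a (mul_root a (conj3 a (conj3 a (x, y, z)))))"])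
        (simp add: level_mul_root_conj3 indec_conj3 indec_mul_root_mul_root norm3_conj3 norm3_mul_root, simp add: level_def)
  next
    case 2
    then show ?thesis
      using assms(1)
      by (intro disjI2 exI[of _ "conj3 a (conj3 a (div_root a (div_root a (conj3 a (x, y, z)))))"])
        (simp add: level_mul_root_conj3 indec_conj3 indec_div_root_div_root norm3_conj3 norm3_div_root, simp add: level_def)
  next
    case 3
    have pos: "0 < 1 + t + t\<^sup>2" for t :: real
      using zero_le_power2[of "t + 1/2"] by (simp add: power2_eq_square algebra_simps)
    have tp: "tot_pos (x, y, z)" if "0 \<le> y" "y \<le> x" "y \<le> z" "(x, y, z) \<noteq> (0, 0, 0)" for x y z
    proof -
      have "0 < ev t (of_int3 (x, y, z))" if "t \<noteq> 0" for t :: real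
      proof -
        have "ev t (of_int3 (x, y, z)) = of_int y * (1 + t + t\<^sup>2) + of_int (x - y) + of_int (z - y) * t\<^sup>2"
          by (simp add: ev_def of_int3_def algebra_simps)
        moreover have "0 \<le> of_int y * (1 + t + t\<^sup>2)" "0 \<le> real_of_int (x - y)" "0 \<le> of_int (z - y) * t\<^sup>2"
          using \<open>0 \<le> y\<close> \<open>y \<le> x\<close> \<open>y \<le> z\<close> pos[of t] by simp_all
        moreover have "0 < of_int y * (1 + t + t\<^sup>2) \<or> 0 < real_of_int (x - y) \<or> 0 < of_int (z - y) * t\<^sup>2"
          using \<open>0 \<le> y\<close> \<open>y \<le> x\<close> \<open>y \<le> z\<close> \<open>(x, y, z) \<noteq> (0, 0, 0)\<close> pos[of t] \<open>t \<noteq> 0\<close>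
          by (auto simp: zero_less_mult_iff)
        ultimately show ?thesis by linarith
      qed
      then show ?thesis using p_pos q_less r_neg unfolding tot_pos_def by auto
    qed
    have "\<not> tot_pos (x - 1, y - 1, z - 1)"
      using indec_tot_pos_minus[OF assms(1) tp[of 1 1 1]] by simp
    \<comment> \<open>\<open>tp\<close> takes its arguments in the order \<open>y\<close>,
      \<open>x\<close>, \<open>z\<close>. Its hypotheses survive subtracting
      \<open>(1, 1, 1)\<close>, so only the difference zero remains.\<close>
    then show ?thesis using tp[of "y - 1" "x - 1" "z - 1"] 3 assms(2) by auto
  qed
qed

text \<open>In the coordinates \<open>v = - x\<close>, \<open>u = - y - v (a + 2)\<close>, the points of level \<open>n\<close> in the cone
  form the triangle with vertices \<open>n (-1, a + 2)\<close>, \<open>n (0, 0)\<close>, \<open>n (a + 1, 1)\<close>. It is the union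
  of the triangle \<open>v \<ge> 0\<close>, \<open>u \<ge> n\<close>, \<open>u + v \<le> n (a + 1)\<close> and of three slivers permuted by
  \<open>cone_rot\<close>; in the sliver \<open>u < n\<close> one can split off \<open>\<rho>\<^sup>2\<close>.\<close>

lemma indec_sliver:
  assumes "indec (x, y, z)" "in_cone a (x, y, z)" "- y + x * (a + 2) < x + z"
  shows "(x, y, z) = (0, 0, 1)"
proof (rule ccontr)
  assume ne: "\<not> ?thesis"
  define D where "D = a^2 + 3 * a + 3"
  have D: "D = (a + 1)^2 + (a + 2)" unfolding D_def by algebra
  then have D0: "D \<ge> 0" using a_ge by simp
  have c: "y \<le> 0" "0 \<le> (a + 2) * y + D * z" "(a + 1) * y \<le> D * x"
    using assms(2) by (auto simp: in_cone_def D_def)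
  \<comment> \<open>Integrality sharpens the strict hypothesis to
    \<open>- y + x * (a + 1) \<le> z - 1\<close>. Eliminating \<open>x\<close> by
    \<open>c(3)\<close> leaves \<open>y\<close> with coefficient
    \<open>- (D - (a + 1)^2) = - (a + 2)\<close>, which is the cone condition on \<open>z\<close>,
    now for \<open>z - 1\<close>.\<close>
  have "D * (- y + x * (a + 1)) \<le> D * (z - 1)"
    using assms(3) D0 by (intro mult_left_mono) (auto simp: algebra_simps)
  moreover have "(a + 1) * ((a + 1) * y) \<le> (a + 1) * (D * x)"
    using c(3) a_ge by (intro mult_left_mono) auto
  ultimately have "- (D * y) + (a + 1)^2 * y \<le> D * (z - 1)"
    by (simp add: algebra_simps power2_eq_square)
  then have "0 \<le> (a + 2) * y + D * (z - 1)" unfolding D by (simp add: algebra_simps)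
  then have "in_cone a (x, y, z - 1)"
    using c by (simp add: in_cone_def D_def)
  then have "tot_pos (x, y, z - 1)" using ne by (intro tot_pos_in_cone) auto
  moreover have "tot_pos (0, 0, 1)"
    by (rule tot_pos_in_cone) (use D0 in \<open>simp_all add: in_cone_def D_def\<close>)
  ultimately show False using indec_tot_pos_minus[OF assms(1), of "(0, 0, 1)"] by simp
qed

text \<open>The inner triangle lies in the cone, whose conditions here read
  \<open>0 \<le> u + v * (a + 2)\<close>, \<open>v \<le> (a + 1) * u\<close> and
  \<open>(a + 2) * u + (a + 1) * v \<le> n * (a^2 + 3 * a + 3)\<close>.\<close>

lemma tot_pos_inner:
  fixes n u v :: int
  assumes "0 < n" "0 \<le> v" "n \<le> u" "u + v \<le> n * (a + 1)"
  shows "tot_pos (- v, - (u + v * (a + 2)), n + v)"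
proof (rule tot_pos_in_cone)
  have "(a + 1) * n \<le> (a + 1) * u" using assms a_ge by (intro mult_left_mono) auto
  then have 1: "v \<le> (a + 1) * u" using assms by (simp add: algebra_simps)
  have "(a + 1) * (u + v) \<le> (a + 1) * (n * (a + 1))"
    using assms a_ge by (intro mult_left_mono) auto
  moreover have "u \<le> n * (a + 1)" using assms by simp
  ultimately have 2: "(a + 2) * u + (a + 1) * v \<le> n * (a\<^sup>2 + 3 * a + 3)"
    using assms(1) by (simp add: algebra_simps power2_eq_square)
  have "0 \<le> v * (a + 2)" using assms a_ge by simp
  then show "in_cone a (- v, - (u + v * (a + 2)), n + v)"
    using assms(1,3) 1 2 unfolding in_cone_def by (simp add: algebra_simps power2_eq_square)
  show "(- v, - (u + v * (a + 2)), n + v) \<noteq> (0, 0, 0)"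
    using assms by auto
qed

text \<open>Each sliver contributes only a vertex, which is a unit; in the inner triangle
  indecomposability forces \<open>n = 1\<close>.\<close>

lemma indec_in_cone_cases:
  assumes s: "indec s" "in_cone a s"
  shows "norm3 a s = 1 \<or> (\<exists>b1 b2 b3. 0 \<le> b1 \<and> 0 \<le> b2 \<and> 0 \<le> b3 \<and> b1 + b2 + b3 = a
     \<and> norm3 a s = tri_norm b1 b2 b3)"
proof (cases s)
  case (fields x y z)
  define n where "n = x + z"
  have n: "n > 0" using level_pos[of s] s unfolding indec_def fields level_def n_def by auto
  have sl: "norm3 a u = 1" if "indec u" "in_cone a u" "- fst (snd u) + fst u * (a + 2) < level u" for u
    using indec_sliver[of "fst u" "fst (snd u)" "snd (snd u)"] that
    by (cases u) (auto simp: level_def norm3_def)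
  define v u where "v = - x" and "u = - y - v * (a + 2)"
  have xyz: "x = - v" "y = - (u + v * (a + 2))" "z = n + v" by (simp_all add: v_def u_def n_def)
  consider "u < n" | "v < 0" | "n * (a + 1) < u + v"
    | "0 \<le> v" "n \<le> u" "u + v \<le> n * (a + 1)" by linarith
  then show ?thesis
  proof cases
    case 1
    have "norm3 a s = 1" by (rule sl) (use 1 s in \<open>simp_all add: fields xyz level_def\<close>)
    then show ?thesis ..
  next
    case 2
    \<comment> \<open>\<open>cone_rot\<close> carries the sliver \<open>v < 0\<close> to the one
      treated by \<open>sl\<close>; for the third sliver two rotations are needed.\<close>
    have "norm3 a (cone_rot a s) = 1"
      by (rule sl) (use 2 s in \<open>simp_all add: indec_cone_rot in_cone_cone_rot level_cone_rot\<close>,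
        simp add: fields cone_rot_eq level_def xyz algebra_simps power2_eq_square)
    then show ?thesis by (simp add: norm3_cone_rot)
  next
    case 3
    have "norm3 a (cone_rot a (cone_rot a s)) = 1"
      by (rule sl) (use 3 s in \<open>simp_all add: indec_cone_rot in_cone_cone_rot level_cone_rot\<close>,
        simp add: fields cone_rot_eq level_def xyz algebra_simps power2_eq_square)
    then show ?thesis by (simp add: norm3_cone_rot)
  next
    case 4
    \<comment> \<open>For \<open>a = - 1\<close> the inner triangle is empty.\<close>
    have "n * 1 \<le> n * (a + 1)" using 4 by simp
    then have a0: "0 \<le> a" using n by (simp add: mult_le_cancel_left)
    have "n = 1"
    proof (rule ccontr)
      assume "n \<noteq> 1"
      with n have n2: "n \<ge> 2" by simp
      \<comment> \<open>A greedy level \<open>1\<close> point: first \<open>v'\<close>, then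
        \<open>u'\<close> is taken as large as possible while the remainder keeps
        \<open>n - 1 \<le> u - u'\<close>.\<close>
      define v' u' where "v' = min v a" and "u' = 1 + min (u - n) (a - v')"
      have "(n - 1) * a \<ge> 0" using n a0 by simp
      moreover have "u + v - n \<le> n * a" using 4 by (simp add: algebra_simps)
      ultimately have *: "0 \<le> v'" "1 \<le> u'" "u' + v' \<le> a + 1" "0 \<le> v - v'" "n - 1 \<le> u - u'"
        "(u - u') + (v - v') \<le> (n - 1) * (a + 1)"
        using 4 a0 by (auto simp: v'_def u'_def min_def algebra_simps)
      have "tot_pos (- v', - (u' + v' * (a + 2)), 1 + v')"
        using * by (intro tot_pos_inner) auto
      moreover have "tot_pos (- (v - v'), - ((u - u') + (v - v') * (a + 2)), (n - 1) + (v - v'))"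
        using * n2 by (intro tot_pos_inner) auto
      moreover have "(- (v - v'), - ((u - u') + (v - v') * (a + 2)), (n - 1) + (v - v'))
         = s - (- v', - (u' + v' * (a + 2)), 1 + v')"
        unfolding fields xyz by (simp add: algebra_simps)
      ultimately show False using indec_tot_pos_minus[OF s(1)] by metis
    qed
    show ?thesis
    proof (intro disjI2 exI conjI)
      \<comment> \<open>The barycentric coordinates are the slacks of the three inequalities of this
        case at \<open>n = 1\<close>.\<close>
      show "norm3 a s = tri_norm v (u - 1) (a + 1 - u - v)"
        unfolding fields xyz \<open>n = 1\<close> tri_norm_def norm3_def prod.case by algebra
    qed (use 4 \<open>n = 1\<close> in auto)
  qed
qed

lemma indec_norm_cases:
  assumes "indec s"
  shows "norm3 a s = 1 \<or> norm3 a s = a^2 + 3 * a + 9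
     \<or> (\<exists>b1 b2 b3. 0 \<le> b1 \<and> 0 \<le> b2 \<and> 0 \<le> b3 \<and> b1 + b2 + b3 = a \<and> norm3 a s = tri_norm b1 b2 b3)"
  using assms
proof (induction "nat (level s)" arbitrary: s rule: less_induct)
  case less
  \<comment> \<open>Stated for any \<open>u\<close> sharing norm and level with \<open>s\<close>, to
    be applied to \<open>s\<close> and its two rotations.\<close>
  have pos: ?case if "indec u" "norm3 a u = norm3 a s" "level u = level s" "0 < fst (snd u)" for u
  proof -
    obtain x y z where u: "u = (x, y, z)" by (cases u)
    have "norm3 a (1, 1, 1) = a^2 + 3 * a + 9" by (simp add: norm3_def)
    moreover have "0 < level u" using level_pos that(1) by (simp add: indec_def)
    moreover have "u = (1, 1, 1) \<or> (\<exists>w. indec w \<and> norm3 a w = norm3 a u \<and> level w < level u)"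
      using indec_y_pos_cases[of x y z] that unfolding u by simp
    ultimately show ?thesis
    proof (elim disjE exE conjE)
      fix w assume w: "indec w" "norm3 a w = norm3 a u" "level w < level u" and "0 < level u"
      then have "nat (level w) < nat (level s)" using that(3) by simp
      from less.hyps[OF this w(1)] show ?thesis unfolding w(2) that(2) .
    qed (use that(2) in simp)
  qed
  show ?case
  proof (cases "in_cone a s")
    case True
    then show ?thesis using indec_in_cone_cases less.prems by blast
  next
    case False
    then show ?thesis
      using pos[of s] pos[of "cone_rot a s"] pos[of "cone_rot a (cone_rot a s)"] less.prems
      by (auto simp: in_cone_iff not_le indec_cone_rot norm3_cone_rot level_cone_rot)
  qed
qed

end

section \<open>The cubic field and its embeddings\<close>

definition of_rat3 :: "rat \<times> rat \<times> rat \<Rightarrow> 'a::field_char_0 \<times> 'a \<times> 'a" where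
  "of_rat3 = (\<lambda>(x, y, z). (of_rat x, of_rat y, of_rat z))"

text \<open>Multiplication in the basis \<open>1\<close>, \<rho>, \<open>\<rho>^2\<close>:
  \<open>c3\<close> and \<open>c4\<close> are the coefficients of \<open>\<rho>^3\<close> and
  \<open>\<rho>^4\<close> before reduction.\<close>

definition mul3 :: "'a::comm_ring_1 \<Rightarrow> 'a \<times> 'a \<times> 'a \<Rightarrow> 'a \<times> 'a \<times> 'a \<Rightarrow> 'a \<times> 'a \<times> 'a" where
  "mul3 a = (\<lambda>(x, y, z) (x', y', z').
     let c3 = y * z' + z * y'; c4 = z * z' in
     (x * x' + c3 + a * c4,
      x * y' + y * x' + (a + 3) * c3 + (a\<^sup>2 + 3 * a + 1) * c4,
      x * z' + y * y' + z * x' + a * c3 + (a\<^sup>2 + a + 3) * c4))"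

lemma of_rat3_add: "of_rat3 (s + u) = of_rat3 s + of_rat3 u"
  by (cases s; cases u) (simp add: of_rat3_def of_rat_add)

lemma of_rat3_diff: "of_rat3 (s - u) = of_rat3 s - of_rat3 u"
  by (cases s; cases u) (simp add: of_rat3_def of_rat_diff)

lemma of_rat3_mul3: "of_rat3 (mul3 (of_int a) s u) = mul3 (of_int a) (of_rat3 s) (of_rat3 u)"
  by (cases s; cases u) (simp add: of_rat3_def mul3_def Let_def of_rat_add of_rat_mult of_rat_power)

lemma of_rat3_conj3: "of_rat3 (conj3 (of_int a) s) = conj3 (of_int a) (of_rat3 s)"
  by (cases s) (simp add: of_rat3_def conj3_def of_rat_add of_rat_diff of_rat_minus of_rat_mult of_rat_power)

lemma of_rat_norm3: "of_rat (norm3 (of_int a) s) = norm3 (of_int a) (of_rat3 s)"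
  by (cases s) (simp add: of_rat3_def norm3_def of_rat_add of_rat_diff of_rat_mult of_rat_power)

lemma of_rat3_of_int3: "of_rat3 (of_int3 s) = of_int3 s"
  by (cases s) (simp add: of_rat3_def of_int3_def)

lemma ev_diff: "ev t (s - u) = ev t s - ev t u"
  by (cases s; cases u) (simp add: ev_def algebra_simps)

lemma ev_mul3:
  assumes "root_of a t"
  shows "ev t (mul3 (of_int a) s u) = ev t s * ev t u"
proof (cases s; cases u)
  fix x y z x' y' z' assume [simp]: "s = (x, y, z)" "u = (x', y', z')"
  have 3: "t ^ 3 = 1 + (of_int a + 3) * t + of_int a * t\<^sup>2"
    using assms by (simp add: root_of_def)
  have "t ^ 4 = t * t ^ 3" by (simp add: power4_eq_xxxx power3_eq_cube)
  also have "\<dots> = t + (of_int a + 3) * t\<^sup>2 + of_int a * t ^ 3"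
    unfolding 3 by (subst 3[symmetric]) (simp add: algebra_simps power2_eq_square power3_eq_cube)
  also have "\<dots> = of_int a + ((of_int a)\<^sup>2 + 3 * of_int a + 1) * t + ((of_int a)\<^sup>2 + of_int a + 3) * t\<^sup>2"
    unfolding 3 by (simp add: algebra_simps power2_eq_square)
  finally have 4: "t ^ 4 = \<dots>" .
  have "ev t s * ev t u = x * x' + (x * y' + y * x') * t + (x * z' + y * y' + z * x') * t\<^sup>2
     + (y * z' + z * y') * t ^ 3 + z * z' * t ^ 4"
    by (simp add: ev_def algebra_simps power2_eq_square power3_eq_cube power4_eq_xxxx)
  also have "\<dots> = ev t (mul3 (of_int a) s u)"
    unfolding 3 4 by (simp add: ev_def mul3_def Let_def algebra_simps)
  finally show ?thesis ..
qed

text \<open>A rational root is an integer dividing \<open>1\<close>. The value \<open>- 1\<close> is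
  never a root, and \<open>1\<close> would give \<open>2 * a + 3 = 0\<close>, impossible by
  parity.\<close>

lemma root_of_not_Rats:
  fixes t :: "'a::field_char_0"
  assumes "root_of a t"
  shows "t \<notin> \<rat>"
proof
  assume "t \<in> \<rat>"
  moreover have "algebraic_int t"
  proof (rule algebraic_int.intros)
    show "lead_coeff [:- 1, - (of_int a + 3), - of_int a, 1 :: 'a:] = 1" by simp
    show "\<forall>i. coeff [:- 1, - (of_int a + 3), - of_int a, 1 :: 'a:] i \<in> \<int>"
      by (auto simp: coeff_pCons split: nat.splits)
    show "poly [:- 1, - (of_int a + 3), - of_int a, 1 :: 'a:] t = 0"
      using assms by (simp add: root_of_def power2_eq_square power3_eq_cube algebra_simps)
  qed
  ultimately obtain n where n: "t = of_int n"
    using rational_algebraic_int_is_int Ints_cases by metis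
  have "of_int (n ^ 3) = (of_int (a * n\<^sup>2 + (a + 3) * n + 1) :: 'a)"
    using assms unfolding root_of_def n by simp
  then have e: "n ^ 3 = a * n\<^sup>2 + (a + 3) * n + 1" by (simp only: of_int_eq_iff)
  then have "n * (n\<^sup>2 - a * n - (a + 3)) = 1" by algebra
  then have "n = 1 \<or> n = - 1" by (auto simp: zmult_eq_1_iff)
  with e have "2 * a + 3 = 0" by auto
  then show False by presburger
qed

lemma ev_of_rat3_eq_0:
  fixes t :: "'a::field_char_0"
  assumes t: "root_of a t" and ev: "ev t (of_rat3 s) = 0"
  shows "s = (0, 0, 0)"
proof (cases s)
  case (fields x y z)
  have e: "of_rat x + of_rat y * t + of_rat z * t\<^sup>2 = 0"
    using ev by (simp add: fields ev_def of_rat3_def)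
  have lin: "d = 0 \<and> c = 0" if "of_rat c + of_rat d * t = 0" for c d
  proof -
    have "d = 0"
    proof (rule ccontr)
      assume "d \<noteq> 0"
      with that have "t = of_rat (- c / d)"
        by (simp add: of_rat_divide of_rat_minus field_simps eq_neg_iff_add_eq_0)
      then show False using root_of_not_Rats[OF t] by simp
    qed
    with that show ?thesis by simp
  qed
  have "z = 0"
  proof (rule ccontr)
    assume z: "z \<noteq> 0"
    define b c where "b = - y / z" and "c = - x / z"
    have t2: "t\<^sup>2 = of_rat b * t + of_rat c"
      using e z by (simp add: b_def c_def of_rat_divide of_rat_minus field_simps)
        (simp add: eq_neg_iff_add_eq_0 ac_simps)
    \<comment> \<open>This is the remainder of the cubic modulo \<open>t^2 - b * t - c\<close>; its
      vanishing makes the cofactor's root \<open>a - b\<close> a rational root.\<close>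
    have "of_rat (b * c - of_int a * c - 1) + of_rat (b\<^sup>2 + c - of_int a * b - (of_int a + 3)) * t = 0"
      using t t2 unfolding root_of_def
      by (simp add: of_rat_diff of_rat_add of_rat_mult of_rat_power) algebra
    then have 0: "b\<^sup>2 + c - of_int a * b - (of_int a + 3) = 0" "b * c - of_int a * c - 1 = 0"
      using lin by blast+
    have "root_of a (of_int a - b)"
      unfolding root_of_def using 0 by algebra
    moreover have "of_int a - b = of_rat (of_int a - b)" by simp
    ultimately show False using root_of_not_Rats Rats_of_rat by metis
  qed
  then show ?thesis using e lin[of x y] fields by simp
qed

lemma ev_of_rat3_inj:
  fixes t :: "'a::field_char_0"
  assumes "root_of a t"
  shows "ev t (of_rat3 s) = ev t (of_rat3 u) \<longleftrightarrow> s = u"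
  using ev_of_rat3_eq_0[OF assms, of "s - u"]
  by (auto simp: of_rat3_diff ev_diff zero_prod_def[symmetric])

text \<open>The inverse is the product of the other two conjugates divided by the norm, and
  \<open>conj3\<close> gives these conjugates in coordinates.\<close>

lemma (in root_cycle) inverse_ev:
  "\<exists>u. inverse (ev p (of_rat3 s)) = ev p (of_rat3 u)"
proof (cases "s = (0, 0, 0)")
  case True
  then show ?thesis by (intro exI[of _ s]) (simp add: ev_def of_rat3_def)
next
  case False
  define n where "n = norm3 (of_int a) s"
  have n: "of_rat n = ev p (of_rat3 s) * ev q (of_rat3 s) * ev r (of_rat3 s)"
    unfolding n_def by (simp add: of_rat_norm3 norm3_eq)
  have "root_of a p" "root_of a q" "root_of a r"
    using root root_cycle.root[OF cycle] root_cycle.root[OF root_cycle.cycle[OF cycle]] by auto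
  then have ne: "ev p (of_rat3 s) \<noteq> 0" "ev q (of_rat3 s) \<noteq> 0" "ev r (of_rat3 s) \<noteq> 0"
    using False ev_of_rat3_eq_0 by blast+
  have "ev p (of_rat3 (conj3 (of_int a) s)) = ev r (of_rat3 s)"
    by (simp add: of_rat3_conj3 ev_conj3)
  moreover have "ev p (of_rat3 (conj3 (of_int a) (conj3 (of_int a) s))) = ev q (of_rat3 s)"
    by (simp add: of_rat3_conj3 ev_conj3 root_cycle.ev_conj3[OF root_cycle.cycle[OF cycle]])
  moreover have "ev p (of_rat3 (1 / n, 0, 0)) = inverse (of_rat n)"
    by (simp add: ev_def of_rat3_def of_rat_divide inverse_eq_divide)
  moreover have "inverse (ev p (of_rat3 s)) = inverse (of_rat n) * (ev q (of_rat3 s) * ev r (of_rat3 s))"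
    unfolding n using ne by (simp add: field_simps)
  ultimately have "inverse (ev p (of_rat3 s)) = ev p (of_rat3 (mul3 (of_int a) (1 / n, 0, 0)
      (mul3 (of_int a) (conj3 (of_int a) (conj3 (of_int a) s)) (conj3 (of_int a) s))))"
    using root by (simp add: of_rat3_mul3 ev_mul3)
  then show ?thesis ..
qed

lemma rat_adjoin_root:
  fixes \<rho> :: "'k::field_char_0"
  assumes "root_of a \<rho>"
  shows "rat_adjoin \<rho> = range (\<lambda>s. ev \<rho> (of_rat3 s))" (is "_ = ?R")
proof
  have "is_subfield ?R"
    unfolding is_subfield_def
  proof (intro conjI ballI)
    have "1 = ev \<rho> (of_rat3 (1, 0, 0))" by (simp add: ev_def of_rat3_def)
    then show "1 \<in> ?R" by blast
  next
    fix x y assume "x \<in> ?R" "y \<in> ?R"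
    then obtain s u where "x = ev \<rho> (of_rat3 s)" "y = ev \<rho> (of_rat3 u)" by blast
    then have "x - y = ev \<rho> (of_rat3 (s - u))" "x * y = ev \<rho> (of_rat3 (mul3 (of_int a) s u))"
      by (simp_all add: of_rat3_diff ev_diff of_rat3_mul3 ev_mul3[OF assms])
    then show "x - y \<in> ?R" "x * y \<in> ?R" by blast+
  next
    fix x assume "x \<in> ?R"
    then obtain s where "x = ev \<rho> (of_rat3 s)" by blast
    then show "inverse x \<in> ?R"
      using root_cycle.inverse_ev[OF root_cycleI[OF assms], of s] by (metis rangeI)
  qed
  moreover have "\<rho> = ev \<rho> (of_rat3 (0, 1, 0))" by (simp add: ev_def of_rat3_def)
  ultimately show "rat_adjoin \<rho> \<subseteq> ?R" unfolding rat_adjoin_def by blast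
next
  have "ev \<rho> (of_rat3 s) \<in> F" if F: "is_subfield F" "\<rho> \<in> F" for F s
  proof -
    have 1: "1 \<in> F" and d: "x - y \<in> F" and m: "x * y \<in> F" and i: "inverse x \<in> F"
      if "x \<in> F" "y \<in> F" for x y
      using F that unfolding is_subfield_def by auto
    have 0: "0 \<in> F" using 1 d F by fastforce
    have p: "x + y \<in> F" if "x \<in> F" "y \<in> F" for x y
      using d[OF that(1) d[OF 0 that(2)]] by simp
    have n: "of_nat k \<in> F" for k by (induction k) (use 0 1 p F in auto)
    have z: "of_int k \<in> F" for k
      by (cases k rule: int_cases2) (use n d[OF 0 n] in auto)
    have q: "of_rat k \<in> F" for k
    proof -
      obtain b c where "k = of_int b / of_int c" by (metis Rat_cases Fract_of_int_quotient)
      then have "of_rat k = (of_int b * inverse (of_int c) :: 'k)"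
        by (simp add: of_rat_divide flip: divide_inverse)
      then show ?thesis by (simp only: m[OF z i[OF z z]])
    qed
    show ?thesis
      by (cases s) (simp add: ev_def of_rat3_def p m q F power2_eq_square)
  qed
  then show "?R \<subseteq> rat_adjoin \<rho>" unfolding rat_adjoin_def by blast
qed

lemma int_adjoin_root:
  fixes \<rho> :: "'k::field_char_0"
  assumes "root_of a \<rho>"
  shows "int_adjoin \<rho> = range (\<lambda>s. ev \<rho> (of_int3 s))"
proof
  have "\<exists>s. poly (map_poly of_int f) \<rho> = ev \<rho> (of_int3 s)" for f :: "int poly"
  proof (induction f)
    case 0
    then show ?case by (intro exI[of _ "(0, 0, 0)"]) (simp add: ev_def of_int3_def)
  next
    case (pCons c f)
    then obtain s where "poly (map_poly of_int f) \<rho> = ev \<rho> (of_int3 s)" by blast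
    then have "poly (map_poly of_int (pCons c f)) \<rho> = ev \<rho> (of_int3 ((c, 0, 0) + mul_root a s))"
      by (simp add: map_poly_pCons of_int3_add ev_add of_int3_mul_root ev_mul_root[OF assms])
        (simp add: ev_def of_int3_def)
    then show ?case ..
  qed
  then show "int_adjoin \<rho> \<subseteq> range (\<lambda>s. ev \<rho> (of_int3 s))" unfolding int_adjoin_def by blast
next
  have "ev \<rho> (of_int3 s) \<in> int_adjoin \<rho>" for s
  proof (cases s)
    case (fields x y z)
    have "ev \<rho> (of_int3 s) = poly (map_poly of_int [:x, y, z:]) \<rho>"
      by (simp add: fields ev_def of_int3_def map_poly_pCons power2_eq_square algebra_simps)
    then show ?thesis unfolding int_adjoin_def by blast
  qed
  then show "range (\<lambda>s. ev \<rho> (of_int3 s)) \<subseteq> int_adjoin \<rho>" by blast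
qed

text \<open>The map \<rho> \<mapsto> \<open>t\<close>, read off from coordinates that are unique
  when \<rho> is a root. The restriction matches the extensionality of
  \<open>embeddings\<close>.\<close>

definition root_embedding :: "'k::field_char_0 \<Rightarrow> 'l::field_char_0 \<Rightarrow> 'k \<Rightarrow> 'l" where
  "root_embedding \<rho> t = restrict (\<lambda>x. ev t (of_rat3 (THE s. x = ev \<rho> (of_rat3 s)))) (rat_adjoin \<rho>)"

lemma root_embedding_ev:
  assumes "root_of a \<rho>"
  shows "root_embedding \<rho> t (ev \<rho> (of_rat3 s)) = ev t (of_rat3 s)"
  using assms by (simp add: root_embedding_def rat_adjoin_root ev_of_rat3_inj)

lemma embedding_of_rat:
  assumes \<sigma>: "\<sigma> \<in> embeddings K" and K: "range of_rat \<subseteq> K"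
  shows "\<sigma> (of_rat c) = of_rat c"
proof -
  have K': "of_rat x \<in> K" for x using K by blast
  have s1: "\<sigma> 1 = 1" using \<sigma> by (simp add: embeddings_def)
  have add: "\<sigma> (of_rat (x + y)) = \<sigma> (of_rat x) + \<sigma> (of_rat y)"
    and mult: "\<sigma> (of_rat (x * y)) = \<sigma> (of_rat x) * \<sigma> (of_rat y)" for x y
    using \<sigma> K' by (simp_all add: embeddings_def of_rat_add of_rat_mult)
  have s0: "\<sigma> (of_rat 0) = 0" using add[of 0 0] by simp
  have nat: "\<sigma> (of_rat (of_nat n)) = of_nat n" for n
    by (induction n) (use s0 s1 add[of 1] in \<open>simp_all\<close>)
  have int: "\<sigma> (of_rat (of_int n)) = of_int n" for n
  proof (cases n rule: int_cases2)
    case (nonneg k)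
    then show ?thesis using nat[of k] by simp
  next
    case (nonpos k)
    have "\<sigma> (of_rat (of_int n)) + \<sigma> (of_rat (of_nat k)) = 0"
      using add[of "of_int n" "of_nat k"] s0 nonpos by simp
    then show ?thesis unfolding nat nonpos by (simp add: eq_neg_iff_add_eq_0)
  qed
  obtain m n where c: "c = of_int m / of_int n" "n \<noteq> 0"
    by (metis Rat_cases Fract_of_int_quotient less_irrefl)
  then have "\<sigma> (of_rat c) * of_int n = of_int m"
    using mult[of c "of_int n"] int[of m] int[of n] by simp
  then have "\<sigma> (of_rat c) = of_int m / of_int n" using c(2) by (simp add: field_simps)
  also have "\<dots> = of_rat c" by (simp add: c(1) of_rat_divide)
  finally show ?thesis .
qed

text \<open>An embedding is determined by the image of \<rho>, which is again a root. The target
  stays general to cover real and complex embeddings.\<close>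

lemma embeddings_rat_adjoin_root:
  fixes \<rho> :: "'k::field_char_0"
  assumes \<rho>: "root_of a \<rho>"
  shows "embeddings (rat_adjoin \<rho>) = root_embedding \<rho> ` {t :: 'l::field_char_0. root_of a t}"
proof (intro equalityI subsetI)
  fix \<sigma> :: "'k \<Rightarrow> 'l" assume \<sigma>: "\<sigma> \<in> embeddings (rat_adjoin \<rho>)"
  let ?K = "rat_adjoin \<rho>"
  have rK: "of_rat c \<in> ?K" for c
  proof -
    have "of_rat c = ev \<rho> (of_rat3 (c, 0, 0))" by (simp add: ev_def of_rat3_def)
    then show ?thesis unfolding rat_adjoin_root[OF \<rho>] by blast
  qed
  have \<rho>K: "\<rho> \<in> ?K" unfolding rat_adjoin_def by blast
  have K: "x + y \<in> ?K" "x * y \<in> ?K" if xy: "x \<in> ?K" "y \<in> ?K" for x y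
  proof -
    obtain s u where "x = ev \<rho> (of_rat3 s)" "y = ev \<rho> (of_rat3 u)"
      using xy unfolding rat_adjoin_root[OF \<rho>] by blast
    then have "x + y = ev \<rho> (of_rat3 (s + u))" "x * y = ev \<rho> (of_rat3 (mul3 (of_int a) s u))"
      by (simp_all add: of_rat3_add ev_add of_rat3_mul3 ev_mul3[OF \<rho>])
    then show "x + y \<in> ?K" "x * y \<in> ?K" unfolding rat_adjoin_root[OF \<rho>] by blast+
  qed
  have \<sigma>r: "\<sigma> (of_rat c) = of_rat c" for c by (rule embedding_of_rat[OF \<sigma>]) (use rK in blast)
  have hom: "\<sigma> (x + y) = \<sigma> x + \<sigma> y" "\<sigma> (x * y) = \<sigma> x * \<sigma> y" if "x \<in> ?K" "y \<in> ?K" for x y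
    using \<sigma> that by (auto simp: embeddings_def)
  have eval: "\<sigma> (ev \<rho> (of_rat3 s)) = ev (\<sigma> \<rho>) (of_rat3 s)" for s
    by (cases s) (simp add: ev_def of_rat3_def power2_eq_square hom K rK \<rho>K \<sigma>r)
  \<comment> \<open>The cubic equation as coordinates of \<open>\<rho>^3\<close>, to which the
    embedding is then applied.\<close>
  have "ev \<rho> (of_rat3 (1, of_int a + 3, of_int a)) = \<rho> * (\<rho> * \<rho>)"
    using \<rho> by (simp add: root_of_def ev_def of_rat3_def power2_eq_square power3_eq_cube of_rat_add algebra_simps)
  then have "ev (\<sigma> \<rho>) (of_rat3 (1, of_int a + 3, of_int a)) = \<sigma> \<rho> * (\<sigma> \<rho> * \<sigma> \<rho>)"
    using eval[of "(1, of_int a + 3, of_int a)"] by (simp add: hom K \<rho>K)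
  then have "root_of a (\<sigma> \<rho>)"
    by (simp add: root_of_def ev_def of_rat3_def power2_eq_square power3_eq_cube of_rat_add algebra_simps)
  moreover have "\<sigma> = root_embedding \<rho> (\<sigma> \<rho>)"
  proof (rule extensionalityI)
    show "\<sigma> \<in> extensional ?K" using \<sigma> by (simp add: embeddings_def)
    show "root_embedding \<rho> (\<sigma> \<rho>) \<in> extensional ?K" by (simp add: root_embedding_def)
    show "\<sigma> x = root_embedding \<rho> (\<sigma> \<rho>) x" if "x \<in> ?K" for x
    proof -
      obtain s where "x = ev \<rho> (of_rat3 s)" using \<open>x \<in> ?K\<close> unfolding rat_adjoin_root[OF \<rho>] by blast
      then show ?thesis by (simp only: eval root_embedding_ev[OF \<rho>])
    qed
  qed
  ultimately show "\<sigma> \<in> root_embedding \<rho> ` {t. root_of a t}" by blast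
next
  fix \<sigma> :: "'k \<Rightarrow> 'l" assume "\<sigma> \<in> root_embedding \<rho> ` {t. root_of a t}"
  then obtain t :: 'l where t: "root_of a t" and \<sigma>: "\<sigma> = root_embedding \<rho> t" by blast
  note emb = root_embedding_ev[OF \<rho>, of t]
  have "\<sigma> \<in> extensional (rat_adjoin \<rho>)" by (simp add: \<sigma> root_embedding_def)
  moreover have "\<sigma> 1 = 1"
    using emb[of "(1, 0, 0)"] by (simp add: \<sigma> ev_def of_rat3_def)
  moreover have "\<sigma> (x + y) = \<sigma> x + \<sigma> y \<and> \<sigma> (x * y) = \<sigma> x * \<sigma> y"
    if xy: "x \<in> rat_adjoin \<rho>" "y \<in> rat_adjoin \<rho>" for x y
  proof -
    obtain s u where "x = ev \<rho> (of_rat3 s)" "y = ev \<rho> (of_rat3 u)"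
      using xy unfolding rat_adjoin_root[OF \<rho>] by blast
    then show ?thesis
      using emb[of s] emb[of u] emb[of "s + u"] emb[of "mul3 (of_int a) s u"]
      by (simp add: \<sigma> of_rat3_add ev_add of_rat3_mul3 ev_mul3[OF \<rho>] ev_mul3[OF t])
  qed
  ultimately show "\<sigma> \<in> embeddings (rat_adjoin \<rho>)" unfolding embeddings_def by blast
qed

section \<open>Real roots and passage from the field to integer triples\<close>

lemma (in root_cycle) root_of_iff: "root_of a t \<longleftrightarrow> t \<in> {p, q, r}"
proof -
  have "t ^ 3 - (of_int a * t\<^sup>2 + (of_int a + 3) * t + 1) = (t - p) * (t - q) * (t - r)"
    using pq qr rp sum pqr by algebra
  then show ?thesis unfolding root_of_def by auto
qed

text \<open>The cubic is negative at \<open>0\<close> and positive at \<open>a + 3\<close>. The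
  positive root \<open>t\<close> between them fixes the signs of \<open>- 1 - 1 / t\<close> and
  \<open>- 1 / (1 + t)\<close>.\<close>

lemma ex_real_root_cycle:
  assumes "- 1 \<le> a"
  shows "\<exists>p q r. real_root_cycle a p q r"
proof -
  define f where "f t = t ^ 3 - of_int a * t\<^sup>2 - (of_int a + 3) * t - 1" for t :: real
  have "\<exists>t\<ge>0. t \<le> of_int a + 3 \<and> f t = 0"
  proof (rule IVT')
    show "continuous_on {0..of_int a + 3} f" unfolding f_def by (intro continuous_intros)
    have "f (of_int a + 3) = 2 * (of_int a + 3)\<^sup>2 - 1"
      unfolding f_def by (simp add: power2_eq_square power3_eq_cube algebra_simps)
    moreover have "(1 :: real)\<^sup>2 \<le> (of_int a + 3)\<^sup>2"
      using assms by (intro power_mono) simp_all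
    ultimately show "0 \<le> f (of_int a + 3)" by simp
  qed (use assms in \<open>simp_all add: f_def\<close>)
  then obtain t :: real where t: "t \<ge> 0" "f t = 0" by blast
  then have "root_of a t" by (simp add: f_def root_of_def)
  moreover have "t \<noteq> 0" using t by (auto simp: f_def)
  ultimately have "real_root_cycle a t (- 1 - 1 / t) (- 1 / (1 + t))"
    using assms t by (intro real_root_cycle.intro root_cycleI real_root_cycle_axioms.intro)
      (simp_all add: field_simps)
  then show ?thesis by blast
qed

lemma (in real_root_cycle) totally_positive_iff:
  fixes \<rho> :: "'k::field_char_0"
  assumes \<rho>: "root_of a \<rho>"
  shows "totally_positive (rat_adjoin \<rho>) (ev \<rho> (of_int3 s)) \<longleftrightarrow> tot_pos s"
proof -
  have "ev \<rho> (of_int3 s) \<in> rat_adjoin \<rho>"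
    unfolding rat_adjoin_root[OF \<rho>] by (metis of_rat3_of_int3 rangeI)
  moreover have "root_embedding \<rho> t (ev \<rho> (of_int3 s)) = ev t (of_int3 s)" for t :: real
    using root_embedding_ev[OF \<rho>, of t "of_int3 s"] by (simp only: of_rat3_of_int3)
  ultimately show ?thesis
    by (auto simp: totally_positive_def embeddings_rat_adjoin_root[OF \<rho>] root_of_iff tot_pos_def)
qed

lemma (in real_root_cycle) indecomposable_imp_indec:
  fixes \<rho> :: "'k::field_char_0"
  assumes \<rho>: "root_of a \<rho>" and int: "ring_of_integers (rat_adjoin \<rho>) = int_adjoin \<rho>"
    and \<alpha>: "indecomposable (rat_adjoin \<rho>) \<alpha>"
  obtains s where "\<alpha> = ev \<rho> (of_int3 s)" "indec s"
proof -
  obtain s where s: "\<alpha> = ev \<rho> (of_int3 s)"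
    using \<alpha> unfolding indecomposable_def int int_adjoin_root[OF \<rho>] by blast
  have "\<not> (tot_pos u \<and> tot_pos v \<and> s = u + v)" for u v
  proof
    assume uv: "tot_pos u \<and> tot_pos v \<and> s = u + v"
    then have "\<alpha> = ev \<rho> (of_int3 u) + ev \<rho> (of_int3 v)"
      by (simp add: s of_int3_add ev_add)
    with uv \<alpha> show False
      unfolding indecomposable_def int int_adjoin_root[OF \<rho>]
      using totally_positive_iff[OF \<rho>] by blast
  qed
  moreover have "tot_pos s"
    using \<alpha> by (simp add: indecomposable_def s totally_positive_iff[OF \<rho>])
  ultimately show ?thesis using that s unfolding indec_def by blast
qed

text \<open>The complex roots are the three real ones, so the product over embeddings is the norm
  form.\<close>

lemma (in real_root_cycle) field_norm_ev:
  fixes \<rho> :: "'k::field_char_0"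
  assumes \<rho>: "root_of a \<rho>"
  shows "field_norm (rat_adjoin \<rho>) (ev \<rho> (of_int3 s)) = of_int (norm3 a s)"
proof -
  let ?K = "rat_adjoin \<rho>" and ?c = complex_of_real
  interpret c: root_cycle a "?c p" "?c q" "?c r"
    using arg_cong[OF pq, of complex_of_real] arg_cong[OF qr, of complex_of_real]
      arg_cong[OF rp, of complex_of_real] arg_cong[OF sum, of complex_of_real]
      arg_cong[OF pqr, of complex_of_real]
    by unfold_locales simp_all
  have emb: "root_embedding \<rho> t (ev \<rho> (of_int3 s)) = ev t (of_int3 s)" for t :: complex and s
    using root_embedding_ev[OF \<rho>, of t "of_int3 s"] by (simp only: of_rat3_of_int3)
  have inj: "inj_on (root_embedding \<rho>) S" for S :: "complex set"
  proof (rule inj_onI)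
    fix t u :: complex assume "root_embedding \<rho> t = root_embedding \<rho> u"
    then show "t = u" using emb[of t "(0, 1, 0)"] emb[of u "(0, 1, 0)"] by (simp add: ev_def of_int3_def)
  qed
  have "(\<Prod>\<sigma>\<in>embeddings ?K. \<sigma> (ev \<rho> (of_int3 s))) = (\<Prod>t\<in>{?c p, ?c q, ?c r}. ev t (of_int3 s))"
    unfolding embeddings_rat_adjoin_root[OF \<rho>] c.root_of_iff
    by (simp only: Collect_mem_eq prod.reindex[OF inj] o_def emb)
  \<comment> \<open>The sign conditions make the roots distinct, so the product has three
    factors.\<close>
  also have "\<dots> = ev (?c p) (of_int3 s) * ev (?c q) (of_int3 s) * ev (?c r) (of_int3 s)"
    using p_pos q_less r_greater r_neg by simp
  also have "\<dots> = of_rat (of_int (norm3 a s))"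
    by (subst of_rat_of_int_eq) (simp only: of_int_norm3 c.norm3_eq)
  finally show ?thesis
    unfolding field_norm_def by (intro the_equality) (simp_all only: of_rat_eq_iff)
qed

text \<open>For \<open>a \<ge> 4\<close> the triangle bound must also cover
  \<open>1 + \<rho> + \<rho>^2\<close>. In \<open>j = A - 1\<close> the difference has nonnegative
  coefficients.\<close>

lemma quadratic_le_tri_bound:
  fixes A a0 :: int
  assumes "0 < A" "a0 \<in> {0, 1, 2}" "a = 3 * A + a0"
  shows "a\<^sup>2 + 3 * a + 9 \<le> tri_bound A a0"
proof -
  define j where "j = A - 1"
  have "0 \<le> j" and A: "A = j + 1" using assms by (simp_all add: j_def)
  then have "0 \<le> j^k" for k by simp
  note this[of 1] this[of 2] this[of 3] this[of 4]
  moreover have "tri_bound A a0 - (a\<^sup>2 + 3 * a + 9) \<in>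
     {3*j^4 + 18*j^3 + 36*j^2 + 27*j^1, 3*j^4 + 22*j^3 + 55*j^2 + 54*j^1 + 10, 3*j^4 + 26*j^3 + 79*j^2 + 98*j^1 + 34}"
    using assms(2) unfolding assms(3) A tri_bound_def
    by (auto simp: algebra_simps power2_eq_square power3_eq_cube power4_eq_xxxx)
  ultimately show ?thesis by (elim insertE emptyE; linarith)
qed

lemma (in real_root_cycle) indec_norm_le:
  assumes s: "indec s" and A: "4 \<le> a \<Longrightarrow> a = 3 * A + a0 \<and> a0 \<in> {0, 1, 2}"
  shows "norm3 a s \<le> (if a \<le> 3 then a\<^sup>2 + 3 * a + 9 else tri_bound A a0)"
proof -
  \<comment> \<open>This puts the norm \<open>1\<close> of units below the bound.\<close>
  have sq: "0 \<le> a\<^sup>2 + 3 * a + 8"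
    using zero_le_power2[of a] a_ge by linarith
  show ?thesis
  proof (cases "a \<le> 3")
    case True
    have "tri_norm b1 b2 b3 \<le> a\<^sup>2 + 3 * a + 9"
      if b: "0 \<le> b1" "0 \<le> b2" "0 \<le> b3" "b1 + b2 + b3 = a" for b1 b2 b3
    proof -
      have "0 \<le> a" using b by simp
      with True have "a = 0 \<or> a = 1 \<or> a = 2 \<or> a = 3" by auto
      \<comment> \<open>\<open>A\<close> and \<open>a0\<close> are constrained only for
        \<open>a \<ge> 4\<close>, so quotient and remainder replace them here. At
        \<open>a = 3\<close> both sides are \<open>27\<close>.\<close>
      then have "tri_bound (a div 3) (a mod 3) \<le> a\<^sup>2 + 3 * a + 9"
        by (auto simp: tri_bound_def)
      moreover have "tri_norm b1 b2 b3 \<le> tri_bound (a div 3) (a mod 3)"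
        using b by (intro tri_norm_le) auto
      ultimately show ?thesis by linarith
    qed
    then show ?thesis using indec_norm_cases[OF s] sq True by auto
  next
    case False
    with A have A: "a = 3 * A + a0" "a0 \<in> {0, 1, 2}" by auto
    with False have "0 < A" by auto
    note bd = quadratic_le_tri_bound[OF this A(2,1)]
    then have "1 \<le> tri_bound A a0" using sq by linarith
    moreover have "tri_norm b1 b2 b3 \<le> tri_bound A a0"
      if "0 \<le> b1" "0 \<le> b2" "0 \<le> b3" "b1 + b2 + b3 = a" for b1 b2 b3
      using that A by (intro tri_norm_le) auto
    ultimately show ?thesis using indec_norm_cases[OF s] bd False by auto
  qed
qed

theorem theorem1p2:
  fixes a :: int and A a0 :: nat
    and \<rho> \<alpha> :: "'k::field_char_0" and K :: "'k set"
  assumes "a \<ge> -1"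
    and "poly [:-1, - (of_int a + 3), - of_int a, 1:] \<rho> = 0"
    and "K = rat_adjoin \<rho>"
    and "ring_of_integers K = int_adjoin \<rho>"
    and "a \<ge> 4 \<Longrightarrow> a = 3 * int A + int a0 \<and> a0 \<in> {0, 1, 2}"
    and "indecomposable K \<alpha>"
  shows "field_norm K \<alpha> \<le>
    (if a \<le> 3 then of_int (a^2 + 3*a + 9)
     else if a0 = 2 then of_nat (3*A^4 + 14*A^3 + 28*A^2 + 27*A + 11)
     else if a0 = 1 then of_nat (3*A^4 + 10*A^3 + 16*A^2 + 13*A + 5)
     else of_nat (3*A^4 + 6*A^3 + 9*A^2 + 6*A + 3))"
proof -
  have \<rho>: "root_of a \<rho>"
    using assms(2) by (simp add: root_of_def power2_eq_square power3_eq_cube algebra_simps)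
  obtain p q r where "real_root_cycle a p q r" using ex_real_root_cycle[OF assms(1)] by blast
  then interpret real_root_cycle a p q r .
  obtain s where s: "\<alpha> = ev \<rho> (of_int3 s)" "indec s"
    using indecomposable_imp_indec[OF \<rho>] assms(3,4,6) by blast
  have "norm3 a s \<le> (if a \<le> 3 then a\<^sup>2 + 3 * a + 9 else tri_bound (int A) (int a0))"
    using s(2) assms(5) by (intro indec_norm_le) auto
  then have "rat_of_int (norm3 a s) \<le> of_int (if a \<le> 3 then a\<^sup>2 + 3 * a + 9 else tri_bound (int A) (int a0))"
    by (simp only: of_int_le_iff)
  moreover have "field_norm K \<alpha> = of_int (norm3 a s)"
    unfolding s(1) assms(3) by (rule field_norm_ev[OF \<rho>])
  moreover have "of_int (if a \<le> 3 then a\<^sup>2 + 3 * a + 9 else tri_bound (int A) (int a0)) =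
    (if a \<le> 3 then of_int (a^2 + 3*a + 9)
     else if a0 = 2 then of_nat (3*A^4 + 14*A^3 + 28*A^2 + 27*A + 11)
     else if a0 = 1 then of_nat (3*A^4 + 10*A^3 + 16*A^2 + 13*A + 5)
     else of_nat (3*A^4 + 6*A^3 + 9*A^2 + 6*A + 3) :: rat)"
    by (simp add: tri_bound_def)
  ultimately show ?thesis by (simp only:)
qed

end
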